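(* Let $j\in\mathbb{N}$ and $x=\langle d,k,m\rangle\in M_n\setminus\{\mathbf{0}\}$. There exists $y\in M_n$ with $y^j=x$ if and only if $d$ is an integer multiple of $j$. In that case such $y$ is unique in $M_n$, and $y=\langle d',k',m'\rangle\in M_n\setminus\{\mathbf{0}\}$ with $$d'=\frac{d}{j},\qquad k'=k+(j-1)\min(0,d'),\qquad m'=m+(j-1)\max(0,d').$$
   Context: Fix an integer $n\ge 2$. For integers $d,k,m$ with $1-\min(0,d)\le k\le m\le n-\max(0,d)$, let $\langle d,k,m\rangle$ denote the $n\times n$ matrix with entries $x_{ij}$ ($i,j\in\{1,\dots,n\}$) equal to $1$ if $k\le i\le m$ and $j-i=d$, and $0$ otherwise. Let $\mathbf{0}$ be the $n\times n$ zero matrix and $M_n=\{\mathbf{0}\}\cup\{\langle d,k,m\rangle: d\in\mathbb{Z},\ k,m\in\mathbb{N},\ 1-\min(0,d)\le k\le m\le n-\max(0,d)\}$, a monoid under matrix multiplication. *)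

theory Defs
  imports "Jordan_Normal_Form.Matrix"
begin

text \<open>
  The coefficients are left generic: only \<open>0\<close> and \<open>1\<close> occur as entries.
  Rows and columns of \<^typ>\<open>'a mat\<close> are indexed from \<open>0\<close>, so position \<open>(i, j)\<close> there is
  the entry \<open>x\<close> with subscripts \<open>i + 1\<close> and \<open>j + 1\<close> in the usual numbering from \<open>1\<close>.
\<close>

definition admissible :: "nat \<Rightarrow> int \<Rightarrow> int \<Rightarrow> int \<Rightarrow> bool" where
  "admissible n d k m \<longleftrightarrow> 1 - min 0 d \<le> k \<and> k \<le> m \<and> m \<le> int n - max 0 d"

definition diag_segment :: "nat \<Rightarrow> int \<Rightarrow> int \<Rightarrow> int \<Rightarrow> 'a :: semiring_1 mat" where
  "diag_segment n d k m =
     mat n n (\<lambda>(i, j). if k \<le> int i + 1 \<and> int i + 1 \<le> m \<and> (int j + 1) - (int i + 1) = d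
                       then 1 else 0)"

text \<open>
  Admissibility forces \<open>1 \<le> k \<le> m\<close>, so letting \<open>k\<close> and \<open>m\<close> range over the integers
  gives the same set as letting them range over the positive integers.
\<close>

definition segment_monoid :: "nat \<Rightarrow> 'a :: semiring_1 mat set" where
  "segment_monoid n = {0\<^sub>m n n} \<union> {diag_segment n d k m | d k m. admissible n d k m}"

end

theory Submission
  imports Defs
begin

text \<open>
  The \<open>j\<close>-th power of \<open>\<langle>d, k, m\<rangle>\<close> has a \<open>1\<close> in row \<open>i\<close> precisely when all of
  \<open>i, i + d, \<dots>, i + (j - 1) d\<close> lie between \<open>k\<close> and \<open>m\<close>, and that \<open>1\<close> is on diagonal \<open>j d\<close>.
  By monotonicity in the step only the two extreme terms matter, so the power is the segment with parameters
  \<open>j d\<close>, \<open>k - (j - 1) min(0, d)\<close>, \<open>m - (j - 1) max(0, d)\<close>. A nonzero segment determines its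
  parameters, so these three equations can be solved for the root.
\<close>

lemma diag_segment_carrier [simp]: "diag_segment n d k m \<in> carrier_mat n n"
  by (simp add: diag_segment_def)

lemma diag_segment_dim [simp]:
  "dim_row (diag_segment n d k m) = n" "dim_col (diag_segment n d k m) = n"
  by (simp_all add: diag_segment_def)

lemma diag_segment_index:
  assumes "i < n" "l < n"
  shows "diag_segment n d k m $$ (i, l) =
    (if k \<le> int i + 1 \<and> int i + 1 \<le> m \<and> int l = int i + d then 1 else 0)"
  using assms by (auto simp: diag_segment_def)

lemma diag_segment_empty: "m < k \<Longrightarrow> diag_segment n d k m = 0\<^sub>m n n"
  by (rule eq_matI) (auto simp: diag_segment_index)

text \<open>Row \<open>i\<close> of the left factor points to row \<open>i + d\<close> of the right
  one, so the bounds \<open>p\<close> and \<open>q\<close> pull back to \<open>p - d\<close> and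
  \<open>q - d\<close>.\<close>

lemma diag_segment_mult:
  assumes "1 \<le> p" "q \<le> int n"
  shows "diag_segment n d k m * diag_segment n e p q =
    (diag_segment n (d + e) (max k (p - d)) (min m (q - d)) :: 'a :: semiring_1 mat)"
    (is "?A * ?B = ?C")
proof (rule eq_matI)
  fix i l assume "i < dim_row ?C" "l < dim_col ?C"
  hence il: "i < n" "l < n" by simp_all
  have "(?A * ?B) $$ (i, l) = (\<Sum>s\<in>{0..<n}. ?A $$ (i, s) * ?B $$ (s, l))"
    using il by (simp add: scalar_prod_def)
  also have "\<dots> = (\<Sum>s\<in>{0..<n}. if int s = int i + d then ?C $$ (i, l) else 0)"
    using il by (intro sum.cong) (auto simp: diag_segment_index)
  also have "\<dots> = ?C $$ (i, l)"
  proof (cases "0 \<le> int i + d \<and> int i + d < int n")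
    case True
    then have "(int s = int i + d) = (nat (int i + d) = s)" for s by auto
    with True show ?thesis by (simp add: nat_less_iff)
  next
    \<comment> \<open>The middle index lies outside the matrix, so no summand survives. The bounds
      \<open>1 \<le> p\<close> and \<open>q \<le> int n\<close> exclude row \<open>i\<close> from
      the segment \<open>?C\<close> as well.\<close>
    case False
    then have zero: "?C $$ (i, l) = 0" using il assms by (auto simp: diag_segment_index)
    show ?thesis unfolding zero by simp
  qed
  finally show "(?A * ?B) $$ (i, l) = ?C $$ (i, l)" .
qed simp_all

text \<open>The bounds on the right may cross; the segment is then empty and the power
  vanishes.\<close>

lemma diag_segment_pow:
  assumes "1 \<le> k" "m \<le> int n"
  shows "diag_segment n d k m ^\<^sub>m Suc j =
    (diag_segment n ((int j + 1) * d) (k - int j * min 0 d) (m - int j * max 0 d)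
      :: 'a :: semiring_1 mat)"
proof (induction j)
  case 0
  show ?case using left_mult_one_mat[OF diag_segment_carrier] by simp
next
  case (Suc j)
  \<comment> \<open>For \<open>d \<ge> 0\<close> the old lower bound prevails, otherwise the one
    from the new factor; for the upper bound it is the reverse.\<close>
  have "max (k - int j * min 0 d) (k - (int j + 1) * d) = k - int (Suc j) * min 0 d"
  proof (cases "0 \<le> d")
    case True
    then have "0 \<le> (int j + 1) * d" by simp
    with True show ?thesis by (simp add: min_absorb1 max_absorb1)
  qed (simp add: min_def max_def algebra_simps)
  moreover have "min (m - int j * max 0 d) (m - (int j + 1) * d) = m - int (Suc j) * max 0 d"
  proof (cases "0 \<le> d")
    case False
    then have "(int j + 1) * d \<le> 0" by (simp add: mult_le_0_iff)
    with False show ?thesis by (simp add: min_absorb1 max_absorb1)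
  qed (simp add: min_def max_def algebra_simps)
  moreover have "(int j + 1) * d + d = (int (Suc j) + 1) * d" by (simp add: algebra_simps)
  ultimately show ?case
    using Suc.IH by (simp add: diag_segment_mult[OF assms] del: of_nat_Suc)
qed

text \<open>Each row from \<open>k\<close> to \<open>m\<close> holds a \<open>1\<close> that the
  other matrix must share; the two extreme rows give the bounds. Keeping \<open>k'\<close> and
  \<open>m'\<close> arbitrary allows a comparison with empty segments.\<close>

lemma diag_segment_subset:
  assumes "admissible n d k m"
    and eq: "(diag_segment n d k m :: 'a :: semiring_1 mat) = diag_segment n d' k' m'"
  shows "d' = d \<and> k' \<le> k \<and> m \<le> m'"
proof -
  have entry: "k' \<le> i \<and> i \<le> m' \<and> d' = d" if "k \<le> i" "i \<le> m" for i
  proof -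
    have r: "nat (i - 1) < n" "nat (i - 1 + d) < n" "int (nat (i - 1)) = i - 1"
      "int (nat (i - 1 + d)) = i - 1 + d"
      using assms(1) that by (auto simp: admissible_def)
    have "(diag_segment n d k m :: 'a mat) $$ (nat (i - 1), nat (i - 1 + d)) = 1"
      using r that by (simp add: diag_segment_index)
    then have "(diag_segment n d' k' m' :: 'a mat) $$ (nat (i - 1), nat (i - 1 + d)) = 1"
      using eq by simp
    then show ?thesis using r by (simp add: diag_segment_index split: if_splits)
  qed
  have "k \<le> m" using assms(1) by (simp add: admissible_def)
  then show ?thesis using entry[of k] entry[of m] by simp
qed

lemma diag_segment_inject:
  assumes "admissible n d k m" "admissible n d' k' m'"
    and "(diag_segment n d k m :: 'a :: semiring_1 mat) = diag_segment n d' k' m'"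
  shows "d' = d \<and> k' = k \<and> m' = m"
  using diag_segment_subset[OF assms(1,3)] diag_segment_subset[OF assms(2) assms(3)[symmetric]]
  by simp

lemma diag_segment_nonzero:
  assumes "admissible n d k m"
  shows "diag_segment n d k m \<noteq> (0\<^sub>m n n :: 'a :: semiring_1 mat)"
proof
  assume "diag_segment n d k m = (0\<^sub>m n n :: 'a mat)"
  \<comment> \<open>Zero is written as an empty segment on a diagonal other than
    \<open>d\<close>.\<close>
  also have "\<dots> = diag_segment n (d + 1) 1 0" by (simp add: diag_segment_empty)
  finally show False using diag_segment_subset[OF assms] by fastforce
qed

lemma diag_segment_pow_eq_iff:
  assumes adm: "admissible n d k m" and adm': "admissible n d' k' m'" and j: "j \<ge> 1"
  shows "diag_segment n d' k' m' ^\<^sub>m j = (diag_segment n d k m :: 'a :: semiring_1 mat) \<longleftrightarrow>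
    d = int j * d' \<and> k' = k + (int j - 1) * min 0 d' \<and> m' = m + (int j - 1) * max 0 d'"
proof -
  obtain i where i: "j = Suc i" using j by (cases j) auto
  let ?K = "k' - int i * min 0 d'" and ?M = "m' - int i * max 0 d'"
  have pow: "diag_segment n d' k' m' ^\<^sub>m j = (diag_segment n (int j * d') ?K ?M :: 'a mat)"
  proof -
    have "1 \<le> k'" "m' \<le> int n" using adm' by (auto simp: admissible_def)
    from diag_segment_pow[OF this, of d' i] show ?thesis
      using i by (simp add: add.commute del: pow_mat.simps)
  qed
  \<comment> \<open>Since \<open>min 0\<close> and \<open>max 0\<close> scale with the factor
    \<open>int j\<close>, the outer bounds carry over from \<open>adm'\<close>; only nonemptiness
    has to be supplied.\<close>
  have adm_pow: "admissible n (int j * d') ?K ?M" if "?K \<le> ?M"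
  proof -
    have "min 0 (int j * d') = min 0 d' + int i * min 0 d'"
      "max 0 (int j * d') = max 0 d' + int i * max 0 d'"
      using i min_mult_distrib_left[of "int j" 0 d'] max_mult_distrib_left[of "int j" 0 d']
      by (simp_all add: distrib_right)
    then show ?thesis using that adm' by (simp add: admissible_def)
  qed
  show ?thesis
  proof
    assume "diag_segment n d' k' m' ^\<^sub>m j = (diag_segment n d k m :: 'a mat)"
    then have eq: "(diag_segment n d k m :: 'a mat) = diag_segment n (int j * d') ?K ?M"
      using pow by simp
    \<comment> \<open>Crossed bounds would make the power zero, but an admissible segment is
      not.\<close>
    then have "?K \<le> ?M"
      using diag_segment_empty diag_segment_nonzero[OF adm, where 'a = 'a] by (metis not_le)
    from diag_segment_inject[OF adm adm_pow[OF this] eq]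
    show "d = int j * d' \<and> k' = k + (int j - 1) * min 0 d' \<and> m' = m + (int j - 1) * max 0 d'"
      using i by auto
  qed (use pow i in auto)
qed

text \<open>Offset \<open>int j * d\<close> leaves a margin of \<open>j\<close> times
  \<open>\<bar>d\<bar>\<close> at one end. The root uses up \<open>j - 1\<close> of these, and the
  one left is what offset \<open>d\<close> requires.\<close>

lemma admissible_root:
  assumes "admissible n (int j * d) k m" and "j \<ge> 1"
  shows "admissible n d (k + (int j - 1) * min 0 d) (m + (int j - 1) * max 0 d)"
proof (cases "0 \<le> d")
  case True
  then have "0 \<le> int j * d" "0 \<le> (int j - 1) * d" using assms(2) by simp_all
  moreover from this True have "min 0 d = 0" "max 0 d = d"
    "min 0 (int j * d) = 0" "max 0 (int j * d) = int j * d" by linarith+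
  ultimately show ?thesis
    using assms(1) unfolding admissible_def left_diff_distrib by linarith
next
  case False
  then have "int j * d \<le> 0" "(int j - 1) * d \<le> 0"
    using assms(2) by (simp_all add: mult_le_0_iff)
  moreover from this False have "min 0 d = d" "max 0 d = 0"
    "min 0 (int j * d) = int j * d" "max 0 (int j * d) = 0" by linarith+
  ultimately show ?thesis
    using assms(1) unfolding admissible_def left_diff_distrib by simp
qed

lemma zero_mat_pow: "j \<ge> 1 \<Longrightarrow> 0\<^sub>m n n ^\<^sub>m j = (0\<^sub>m n n :: 'a :: semiring_1 mat)"
  by (cases j) (auto intro!: right_mult_zero_mat pow_carrier_mat)

theorem theorem6:
  fixes n j :: nat and d k m :: int and x :: "'a :: semiring_1 mat"
  assumes "n \<ge> 2" and "j \<ge> 1"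
    and "admissible n d k m" and "x = diag_segment n d k m"
  shows "((\<exists>y \<in> segment_monoid n. y ^\<^sub>m j = x) \<longleftrightarrow> int j dvd d) \<and>
         (int j dvd d \<longrightarrow>
           (\<exists>!y. y \<in> segment_monoid n \<and> y ^\<^sub>m j = x) \<and>
           (let d' = d div int j;
                k' = k + (int j - 1) * min 0 d';
                m' = m + (int j - 1) * max 0 d'
            in admissible n d' k' m' \<and>
               diag_segment n d' k' m' \<in> segment_monoid n - {0\<^sub>m n n :: 'a mat} \<and>
               (\<forall>y \<in> segment_monoid n. y ^\<^sub>m j = x \<longrightarrow> y = diag_segment n d' k' m')))"
proof -
  let ?d = "d div int j"
  let ?k = "k + (int j - 1) * min 0 ?d" and ?m = "m + (int j - 1) * max 0 ?d"
  let ?y = "diag_segment n ?d ?k ?m :: 'a mat"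
  have root: "int j dvd d \<and> y = ?y" if y: "y \<in> segment_monoid n" "y ^\<^sub>m j = x" for y
  proof -
    \<comment> \<open>Positive powers of zero are zero, whereas \<open>x\<close> is not.\<close>
    have "y \<noteq> 0\<^sub>m n n"
      using y(2) zero_mat_pow[OF assms(2)] diag_segment_nonzero[OF assms(3)] assms(4) by metis
    then obtain d' k' m' where adm': "admissible n d' k' m'" and yd: "y = diag_segment n d' k' m'"
      using y(1) by (auto simp: segment_monoid_def)
    from diag_segment_pow_eq_iff[OF assms(3) adm' assms(2), where 'a = 'a] y(2)
    have "d = int j * d'" "k' = k + (int j - 1) * min 0 d'" "m' = m + (int j - 1) * max 0 d'"
      using yd assms(4) by auto
    then show ?thesis using yd assms(2) by simp
  qed
  have exists: "admissible n ?d ?k ?m \<and> ?y \<in> segment_monoid n - {0\<^sub>m n n} \<and> ?y ^\<^sub>m j = x"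
    if "int j dvd d"
  proof -
    \<comment> \<open>Divisibility makes the quotient exact, so \<open>admissible_root\<close>
      applies to \<open>?d\<close>.\<close>
    have d: "int j * ?d = d" using that by simp
    then have adm': "admissible n ?d ?k ?m"
      using admissible_root[of n j ?d k m] assms(2,3) by simp
    then show ?thesis
      using diag_segment_pow_eq_iff[OF assms(3) adm' assms(2), where 'a = 'a] d assms(4)
        diag_segment_nonzero[OF adm', where 'a = 'a]
      by (auto simp: segment_monoid_def)
  qed
  show ?thesis
    unfolding Let_def using root exists by blast
qed

end
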